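(* Let $A$ be any nonempty compact metric space. Then $\underline{\dim}_{\mathrm{Div}} A = \underline{\dim}_{\mathrm{Mink}} A$ and $\overline{\dim}_{\mathrm{Div}} A = \overline{\dim}_{\mathrm{Mink}} A$. Consequently, $\dim_{\mathrm{Div}} A$ is defined if and only if $\dim_{\mathrm{Mink}} A$ is defined, and in that case $\dim_{\mathrm{Div}} A = \dim_{\mathrm{Mink}} A$.
   Context: For a compact metric space $(A,d)$, let $P(A)$ be the set of Borel probability measures on $A$. The maximum diversity of $A$ is $$|A|_+ := \sup_{\mu\in P(A)}\left(\int\int e^{-d(a,b)}\,d\mu(a)\,d\mu(b)\right)^{-1}.$$ For $t>0$, $tA$ denotes the metric space $(A,td)$. Diversity dimensions: $\overline{\dim}_{\mathrm{Div}} A := \limsup_{t\to\infty}\frac{\log|tA|_+}{\log t}$ and $\underline{\dim}_{\mathrm{Div}} A := \liminf_{t\to\infty}\frac{\log|tA|_+}{\log t}$; when these are equal, $\dim_{\mathrm{Div}} A$ is defined to be the common value. Minkowski dimensions: for $\varepsilon>0$ let $N(A,\varepsilon)$ be the minimum number of closed $\varepsilon$-balls needed to cover $A$. $\overline{\dim}_{\mathrm{Mink}} A := \limsup_{\varepsilon\to0^+}\frac{\log N(A,\varepsilon)}{\log(1/\varepsilon)}$ and $\underline{\dim}_{\mathrm{Mink}} A := \liminf_{\varepsilon\to0^+}\frac{\log N(A,\varepsilon)}{\log(1/\varepsilon)}$ (equivalently, one may replace $N(A,\varepsilon)$ by the maximum number $M(A,\varepsilon)$ of disjoint closed $\varepsilon$-balls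 in $A$); when these are equal, $\dim_{\mathrm{Mink}} A$ is defined to be the common value. All dimensions may take the value $+\infty$. *)

theory Defs
  imports "HOL-Probability.Probability"
begin

definition metric_borel :: "'a metric \<Rightarrow> 'a measure" where
  "metric_borel A = sigma (mspace A) {U. openin (mtopology_of A) U}"

definition borel_probs :: "'a metric \<Rightarrow> 'a measure set" where
  "borel_probs A = {\<mu>. prob_space \<mu> \<and> sets \<mu> = sets (metric_borel A)}"

lemma space_borel_probs: "\<mu> \<in> borel_probs A \<Longrightarrow> space \<mu> = mspace A"
  unfolding borel_probs_def metric_borel_def
  by (auto dest: sets_eq_imp_space_eq simp: space_measure_of_conv)

(* The supremum is taken in the reals: when A is compact the values are bounded above, because
   a partition into n Borel sets of diameter at most 1 bounds the double integral below by
   exp (-1) / n. *)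
definition max_diversity :: "'a metric \<Rightarrow> real" where
  "max_diversity A =
     (SUP \<mu>\<in>borel_probs A. inverse (\<integral>b. (\<integral>a. exp (- mdist A a b) \<partial>\<mu>) \<partial>\<mu>))"

(* A metric only for t > 0. *)
definition scale_metric :: "real \<Rightarrow> 'a metric \<Rightarrow> 'a metric" where
  "scale_metric t A = metric (mspace A, \<lambda>x y. t * mdist A x y)"

lemma Metric_space_scale: "t > 0 \<Longrightarrow> Metric_space (mspace A) (\<lambda>x y. t * mdist A x y)"
proof
  fix x y z
  assume "t > 0" and xyz: "x \<in> mspace A" "y \<in> mspace A" "z \<in> mspace A"
  then have "t * mdist A x z \<le> t * (mdist A x y + mdist A y z)"
    by (intro mult_left_mono mdist_triangle) auto
  then show "t * mdist A x z \<le> t * mdist A x y + t * mdist A y z"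
    by (simp add: distrib_left)
qed (auto simp: mdist_commute)

lemma mspace_scale_metric [simp]: "t > 0 \<Longrightarrow> mspace (scale_metric t A) = mspace A"
  and mdist_scale_metric [simp]: "t > 0 \<Longrightarrow> mdist (scale_metric t A) x y = t * mdist A x y"
  unfolding scale_metric_def
  by (simp_all add: Metric_space.mspace_metric Metric_space.mdist_metric Metric_space_scale)

definition upper_div_dim :: "'a metric \<Rightarrow> ereal" where
  "upper_div_dim A = Limsup at_top (\<lambda>t::real. ereal (ln (max_diversity (scale_metric t A)) / ln t))"

definition lower_div_dim :: "'a metric \<Rightarrow> ereal" where
  "lower_div_dim A = Liminf at_top (\<lambda>t::real. ereal (ln (max_diversity (scale_metric t A)) / ln t))"

definition div_dim_defined :: "'a metric \<Rightarrow> bool" where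
  "div_dim_defined A \<longleftrightarrow> upper_div_dim A = lower_div_dim A"

definition div_dim :: "'a metric \<Rightarrow> ereal" where
  "div_dim A = (THE s. upper_div_dim A = s \<and> lower_div_dim A = s)"

(* The balls are centred at points of A. *)
definition covering_number :: "'a metric \<Rightarrow> real \<Rightarrow> nat" where
  "covering_number A \<epsilon> =
     (LEAST n. \<exists>\<B>. finite \<B> \<and> card \<B> = n \<and> \<B> \<subseteq> (\<lambda>x. mcball_of A x \<epsilon>) ` mspace A \<and> mspace A \<subseteq> \<Union>\<B>)"

definition upper_mink_dim :: "'a metric \<Rightarrow> ereal" where
  "upper_mink_dim A =
     Limsup (at_right 0) (\<lambda>\<epsilon>::real. ereal (ln (real (covering_number A \<epsilon>)) / ln (1 / \<epsilon>)))"

definition lower_mink_dim :: "'a metric \<Rightarrow> ereal" where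
  "lower_mink_dim A =
     Liminf (at_right 0) (\<lambda>\<epsilon>::real. ereal (ln (real (covering_number A \<epsilon>)) / ln (1 / \<epsilon>)))"

definition mink_dim_defined :: "'a metric \<Rightarrow> bool" where
  "mink_dim_defined A \<longleftrightarrow> upper_mink_dim A = lower_mink_dim A"

definition mink_dim :: "'a metric \<Rightarrow> ereal" where
  "mink_dim A = (THE s. upper_mink_dim A = s \<and> lower_mink_dim A = s)"

end

theory Submission
  imports Defs "HOL-Real_Asymp.Real_Asymp"
begin

text \<open>The proof compares diversity with covering numbers at a single scale, for a fixed nonempty
  compact space, and then rescales. Write \<open>E(\<mu>)\<close> for the double integral of \<open>exp (- d(a, b))\<close>, so
  that the maximum diversity is the supremum of \<open>1 / E(\<mu>)\<close>, and let \<open>N(r)\<close> be the covering number.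

  A cover by \<open>N(r)\<close> balls can be cut into disjoint pieces of diameter at most \<open>2 r\<close>. Keeping only the
  pairs of points that lie in a common piece, and applying the Cauchy-Schwarz inequality to the masses of
  the pieces, gives \<open>E(\<mu>) \<ge> exp (- 2 r) / N(r)\<close> (\<open>energy_ge_of_cover\<close>). Conversely, the uniform
  measure on a maximal \<open>r\<close>-separated set has \<open>E(\<mu>) \<le> 1 / N(r) + exp (- r)\<close>
  (\<open>ex_energy_le_of_separated\<close>, \<open>ex_separated_card_ge_covering_number\<close>). Applied to \<open>t A\<close> with
  \<open>r = t \<epsilon>\<close>, the two estimates say that for all positive \<open>t\<close> and \<open>\<epsilon>\<close>
  the logarithm of the maximum diversity of \<open>t A\<close> lies between \<open>min (ln N(\<epsilon>)) (t \<epsilon>) - ln 2\<close> and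
  \<open>2 t \<epsilon> + ln N(\<epsilon>)\<close> (\<open>ln_max_diversity_scale_bounds\<close>), where now \<open>N\<close> refers to \<open>A\<close>.

  In the upper bound \<open>\<epsilon> = 1 / t\<close> is harmless, and it bounds both diversity dimensions by the
  Minkowski dimensions. The lower bound is useful only if \<open>t \<epsilon>\<close> is large compared with
  \<open>ln t\<close>, for otherwise the minimum could be \<open>t \<epsilon>\<close>. A squared logarithm is enough: when
  \<open>t \<epsilon>\<close> is \<open>(ln t)\<^sup>2\<close> or \<open>(ln \<epsilon>)\<^sup>2\<close>, the quotient of \<open>ln (1 / \<epsilon>)\<close> by \<open>ln t\<close> still tends to \<open>1\<close>,
  so that no growth exponent is lost (\<open>mink_quot_le_div_quot_along\<close>).\<close>

section \<open>Borel measurability of Lipschitz functions\<close>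

lemma space_metric_borel [simp]: "space (metric_borel A) = mspace A"
  by (simp add: metric_borel_def space_measure_of_conv)

lemma openin_mtopology_of:
  "openin (mtopology_of A) U \<longleftrightarrow> U \<subseteq> mspace A \<and> (\<forall>x\<in>U. \<exists>r>0. mball_of A x r \<subseteq> U)"
  using Metric_space.openin_mtopology[OF Metric_space_mspace_mdist, of A U]
  by (auto simp: mtopology_of_def mball_of_def)

lemma openin_in_sets_metric_borel:
  assumes "openin (mtopology_of A) U"
  shows "U \<in> sets (metric_borel A)"
proof -
  have "{U. openin (mtopology_of A) U} \<subseteq> Pow (mspace A)"
    by (auto simp: openin_mtopology_of)
  then show ?thesis
    using assms by (auto simp: metric_borel_def)
qed

lemma mcball_of_in_sets_metric_borel: "mcball_of A x r \<in> sets (metric_borel A)"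
proof -
  have "closedin (mtopology_of A) (mcball_of A x r)"
    by (simp add: mtopology_of_def mcball_of_def Metric_space.closedin_mcball)
  then have "openin (mtopology_of A) (mspace A - mcball_of A x r)"
    by (simp add: closedin_def)
  then have "space (metric_borel A) - (mspace A - mcball_of A x r) \<in> sets (metric_borel A)"
    by (intro sets.compl_sets openin_in_sets_metric_borel)
  moreover have "space (metric_borel A) - (mspace A - mcball_of A x r) = mcball_of A x r"
    by auto
  ultimately show ?thesis by simp
qed

lemma Lipschitz_imp_metric_borel_measurable:
  fixes f :: "'a \<Rightarrow> real"
  assumes lip: "\<And>x y. x \<in> mspace A \<Longrightarrow> y \<in> mspace A \<Longrightarrow> \<bar>f x - f y\<bar> \<le> mdist A x y"
  shows "f \<in> borel_measurable (metric_borel A)"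
proof (rule borel_measurableI)
  fix S :: "real set"
  assume "open S"
  have "openin (mtopology_of A) (f -` S \<inter> mspace A)"
    unfolding openin_mtopology_of
  proof (intro conjI ballI)
    fix x assume x: "x \<in> f -` S \<inter> mspace A"
    then obtain e where e: "e > 0" "ball (f x) e \<subseteq> S"
      using \<open>open S\<close> open_contains_ball by blast
    have "mball_of A x e \<subseteq> f -` S \<inter> mspace A"
    proof
      fix y assume y: "y \<in> mball_of A x e"
      then have "f y \<in> ball (f x) e"
        using lip[of x y] by (simp add: dist_real_def)
      with e y show "y \<in> f -` S \<inter> mspace A" by auto
    qed
    with e show "\<exists>r>0. mball_of A x r \<subseteq> f -` S \<inter> mspace A" by blast
  qed auto
  then show "f -` S \<inter> space (metric_borel A) \<in> sets (metric_borel A)"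
    by (simp add: openin_in_sets_metric_borel)
qed

section \<open>The energy of a measure\<close>

definition energy :: "'a metric \<Rightarrow> 'a measure \<Rightarrow> real" where
  "energy A \<mu> = (\<integral>b. (\<integral>a. exp (- mdist A a b) \<partial>\<mu>) \<partial>\<mu>)"

lemma max_diversity_eq_SUP_energy:
  "max_diversity A = (SUP \<mu>\<in>borel_probs A. inverse (energy A \<mu>))"
  by (simp add: max_diversity_def energy_def)

lemma exp_neg_Lipschitz:
  fixes x y :: real
  assumes "0 \<le> x" "0 \<le> y"
  shows "\<bar>exp (- x) - exp (- y)\<bar> \<le> \<bar>x - y\<bar>"
proof -
  have *: "exp (- u) - exp (- v) \<le> v - u" if "0 \<le> u" "u \<le> v" for u v :: real
  proof -
    have "exp (- u) - exp (- v) = exp (- u) * (1 - exp (u - v))"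
      by (simp add: algebra_simps flip: exp_add)
    also have "\<dots> \<le> 1 * (1 - exp (u - v))"
      using that by (intro mult_right_mono) auto
    also have "\<dots> \<le> v - u"
      using exp_ge_add_one_self[of "u - v"] unfolding mult_1 by linarith
    finally show ?thesis .
  qed
  show ?thesis
    using *[of x y] *[of y x] assms by (cases "x \<le> y") auto
qed

lemma mdist_diff_le:
  assumes "a \<in> mspace A" "b \<in> mspace A" "c \<in> mspace A"
  shows "\<bar>mdist A a b - mdist A a c\<bar> \<le> mdist A b c"
  using mdist_triangle[of a A b c] mdist_triangle[of a A c b] assms
  by (simp add: mdist_commute)

lemma kernel_Lipschitz:
  assumes "a \<in> mspace A" "b \<in> mspace A" "c \<in> mspace A"
  shows "\<bar>exp (- mdist A a b) - exp (- mdist A a c)\<bar> \<le> mdist A b c"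
  using exp_neg_Lipschitz[of "mdist A a b" "mdist A a c"] mdist_diff_le[OF assms] by simp

lemma borel_probs_D:
  assumes "\<mu> \<in> borel_probs A"
  shows "prob_space \<mu>" "sets \<mu> = sets (metric_borel A)" "space \<mu> = mspace A"
    "measurable \<mu> N = measurable (metric_borel A) N"
  using assms space_borel_probs[OF assms]
  by (auto simp: borel_probs_def intro!: measurable_cong_sets)

lemma kernel_measurable:
  assumes "b \<in> mspace A"
  shows "(\<lambda>a. exp (- mdist A a b)) \<in> borel_measurable (metric_borel A)"
  using kernel_Lipschitz[OF assms]
  by (intro Lipschitz_imp_metric_borel_measurable) (simp add: mdist_commute)

lemma kernel_integrable:
  assumes "\<mu> \<in> borel_probs A" "b \<in> mspace A"
  shows "integrable \<mu> (\<lambda>a. exp (- mdist A a b))"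
proof -
  interpret prob_space \<mu> using borel_probs_D[OF assms(1)] by simp
  show ?thesis
    by (rule integrable_const_bound[where B = 1])
       (use kernel_measurable[OF assms(2)] assms in \<open>auto simp: borel_probs_D\<close>)
qed

text \<open>The potential is again 1-Lipschitz, being an average of 1-Lipschitz functions. The Bochner
  integral of a non-measurable function is \<open>0\<close>, so measurability of the outer integrand is what
  makes a lower bound on the energy possible.\<close>
lemma potential_measurable:
  assumes "\<mu> \<in> borel_probs A"
  shows "(\<lambda>b. \<integral>a. exp (- mdist A a b) \<partial>\<mu>) \<in> borel_measurable (metric_borel A)"
proof (rule Lipschitz_imp_metric_borel_measurable)
  interpret prob_space \<mu> using borel_probs_D[OF assms] by simp
  fix b c assume bc: "b \<in> mspace A" "c \<in> mspace A"
  note int = kernel_integrable[OF assms bc(1)] kernel_integrable[OF assms bc(2)]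
  have "\<bar>(\<integral>a. exp (- mdist A a b) \<partial>\<mu>) - (\<integral>a. exp (- mdist A a c) \<partial>\<mu>)\<bar>
      = \<bar>\<integral>a. (exp (- mdist A a b) - exp (- mdist A a c)) \<partial>\<mu>\<bar>"
    using int by simp
  also have "\<dots> \<le> (\<integral>a. \<bar>exp (- mdist A a b) - exp (- mdist A a c)\<bar> \<partial>\<mu>)"
    by (rule integral_abs_bound)
  also have "\<dots> \<le> (\<integral>a. mdist A b c \<partial>\<mu>)"
    using int bc kernel_Lipschitz[where A = A] by (intro integral_mono) (auto simp: borel_probs_D[OF assms])
  also have "\<dots> = mdist A b c" by (simp add: prob_space)
  finally show "\<bar>(\<integral>a. exp (- mdist A a b) \<partial>\<mu>) - (\<integral>a. exp (- mdist A a c) \<partial>\<mu>)\<bar> \<le> mdist A b c" .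
qed

lemma potential_integrable:
  assumes "\<mu> \<in> borel_probs A"
  shows "integrable \<mu> (\<lambda>b. \<integral>a. exp (- mdist A a b) \<partial>\<mu>)"
proof -
  interpret prob_space \<mu> using borel_probs_D[OF assms] by simp
  have "\<bar>\<integral>a. exp (- mdist A a b) \<partial>\<mu>\<bar> \<le> 1" if "b \<in> mspace A" for b
  proof -
    have "(\<integral>a. exp (- mdist A a b) \<partial>\<mu>) \<le> (\<integral>a. 1 \<partial>\<mu>)"
      using kernel_integrable[OF assms that] by (intro integral_mono) auto
    moreover have "(\<integral>a. exp (- mdist A a b) \<partial>\<mu>) \<ge> 0" by simp
    ultimately show ?thesis by (simp add: prob_space)
  qed
  then show ?thesis
    by (intro integrable_const_bound[where B = 1])
       (use potential_measurable[OF assms] in \<open>auto simp: borel_probs_D[OF assms]\<close>)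
qed

section \<open>Covers bound the energy from below\<close>

text \<open>Disjointify the cover into pieces of diameter at most \<open>2 r\<close>. On pairs from the same piece
  the kernel is at least \<open>exp (- 2 r)\<close>, so the energy is at least \<open>exp (- 2 r)\<close> times the sum of the
  squared masses of the pieces, and that sum is smallest when the masses are equal.\<close>
lemma energy_ge_of_cover:
  assumes \<mu>: "\<mu> \<in> borel_probs A"
    and B: "\<B> \<subseteq> (\<lambda>x. mcball_of A x r) ` mspace A" "finite \<B>" "mspace A \<subseteq> \<Union>\<B>"
  shows "exp (- 2 * r) \<le> energy A \<mu> * card \<B>"
proof -
  interpret prob_space \<mu> using borel_probs_D[OF \<mu>] by simp
  define n where "n = card \<B>"
  obtain h where h: "bij_betw h {0..<n} \<B>"
    using ex_bij_betw_nat_finite[OF \<open>finite \<B>\<close>] n_def by blast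
  define P where "P = disjointed h"
  have hB: "h i \<in> \<B>" if "i < n" for i
    using h that by (auto simp: bij_betw_def)
  have h_sets: "h i \<in> sets \<mu>" if "i < n" for i
    using hB[OF that] B(1) mcball_of_in_sets_metric_borel[of A] by (auto simp: borel_probs_D[OF \<mu>])
  have P_sets: "P i \<in> sets \<mu>" if "i < n" for i
    unfolding P_def disjointed_def
    by (intro sets.Diff sets.finite_UN) (use that h_sets in auto)
  have UN_P: "(\<Union>i\<in>{0..<n}. P i) = mspace A"
  proof -
    have "(\<Union>i\<in>{0..<n}. h i) = \<Union>\<B>" using h by (auto simp: bij_betw_def)
    moreover have "\<Union>\<B> \<subseteq> mspace A" using B(1) by force
    ultimately show ?thesis using B(3) by (simp add: P_def finite_UN_disjointed_eq)
  qed
  have disj: "disjoint_family_on P {0..<n}"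
    using disjoint_family_disjointed[of h]
    by (auto simp: P_def disjoint_family_on_def)
  have diam: "mdist A a b \<le> 2 * r" if "i < n" "a \<in> P i" "b \<in> P i" for i a b
  proof -
    obtain x where x: "x \<in> mspace A" "h i = mcball_of A x r"
      using hB[OF \<open>i < n\<close>] B(1) by blast
    then have ab: "a \<in> mcball_of A x r" "b \<in> mcball_of A x r"
      using that disjointed_subset[of h i] by (auto simp: P_def)
    then show ?thesis
      using mdist_triangle[of a A x b] x by (simp add: mdist_commute)
  qed
  have potential: "(\<Sum>i<n. exp (- 2 * r) * prob (P i) * indicator (P i) b) \<le> (\<integral>a. exp (- mdist A a b) \<partial>\<mu>)"
    if "b \<in> mspace A" for b
  proof -
    obtain i where i: "i < n" "b \<in> P i" using \<open>b \<in> mspace A\<close> UN_P by force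
    have "(\<Sum>j<n. exp (- 2 * r) * prob (P j) * indicator (P j) b)
        = (\<Sum>j<n. if j = i then exp (- 2 * r) * prob (P i) else 0)"
    proof (rule sum.cong)
      fix j assume "j \<in> {..<n}"
      then show "exp (- 2 * r) * prob (P j) * indicator (P j) b
          = (if j = i then exp (- 2 * r) * prob (P i) else 0)"
        using disjoint_family_onD[OF disj, of j i] i by (auto simp: indicator_def)
    qed simp
    also have "\<dots> = exp (- 2 * r) * prob (P i)" using i by simp
    also have "\<dots> = (\<integral>a. exp (- 2 * r) * indicator (P i) a \<partial>\<mu>)"
      using P_sets[OF i(1)] by simp
    also have "\<dots> \<le> (\<integral>a. exp (- mdist A a b) \<partial>\<mu>)"
    proof (rule integral_mono)
      show "integrable \<mu> (\<lambda>a. exp (- 2 * r) * indicator (P i) a)"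
        using P_sets[OF i(1)] by (intro integrable_mult_right) (simp add: integrable_indicator_iff emeasure_eq_measure)
      show "exp (- 2 * r) * indicator (P i) a \<le> exp (- mdist A a b)" for a
        using diam[OF i(1) _ i(2), of a] by (auto simp: indicator_def)
    qed (rule kernel_integrable[OF \<mu> that])
    finally show ?thesis .
  qed
  have "(\<integral>b. (\<Sum>i<n. exp (- 2 * r) * prob (P i) * indicator (P i) b) \<partial>\<mu>) \<le> energy A \<mu>"
    unfolding energy_def
  proof (rule integral_mono)
    show "integrable \<mu> (\<lambda>b. \<Sum>i<n. exp (- 2 * r) * prob (P i) * indicator (P i) b)"
      using P_sets by (intro Bochner_Integration.integrable_sum integrable_mult_right)
        (auto simp: integrable_indicator_iff emeasure_eq_measure)
  qed (use potential in \<open>auto intro: potential_integrable \<mu> simp: borel_probs_D[OF \<mu>]\<close>)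
  also have "(\<integral>b. (\<Sum>i<n. exp (- 2 * r) * prob (P i) * indicator (P i) b) \<partial>\<mu>)
      = (\<Sum>i<n. \<integral>b. exp (- 2 * r) * prob (P i) * indicator (P i) b \<partial>\<mu>)"
    using P_sets by (intro Bochner_Integration.integral_sum integrable_mult_right)
      (auto simp: integrable_indicator_iff emeasure_eq_measure)
  also have "\<dots> = exp (- 2 * r) * (\<Sum>i<n. (prob (P i))\<^sup>2)"
    using P_sets by (simp add: sum_distrib_left power2_eq_square mult.assoc)
  finally have E: "exp (- 2 * r) * (\<Sum>i<n. (prob (P i))\<^sup>2) \<le> energy A \<mu>" .
  have "(\<Sum>i<n. prob (P i)) = prob (\<Union>i\<in>{0..<n}. P i)"
    using P_sets disj by (subst finite_measure_finite_Union) (auto simp: atLeast0LessThan)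
  also have "\<dots> = 1"
    using UN_P prob_space by (simp add: borel_probs_D[OF \<mu>])
  finally have "1 \<le> (\<Sum>i<n. (prob (P i))\<^sup>2) * n"
    using sum_squared_le_sum_of_squares[of "\<lambda>i. prob (P i)" "{..<n}"] by simp
  then have "exp (- 2 * r) * 1 \<le> exp (- 2 * r) * ((\<Sum>i<n. (prob (P i))\<^sup>2) * n)"
    by (intro mult_left_mono) auto
  also have "\<dots> \<le> energy A \<mu> * n"
    using mult_right_mono[OF E, of n] by (simp add: mult.assoc)
  finally show ?thesis by (simp add: n_def)
qed

section \<open>Separated sets bound the energy of a uniform measure from above\<close>

text \<open>In the double sum over a set of \<open>m\<close> points, the diagonal contributes \<open>1 / m\<close> and every other
  term is at most \<open>exp (- r)\<close>.\<close>
lemma ex_energy_le_of_separated: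
  assumes X: "finite X" "X \<noteq> {}" "X \<subseteq> mspace A"
    and sep: "\<And>x y. x \<in> X \<Longrightarrow> y \<in> X \<Longrightarrow> x \<noteq> y \<Longrightarrow> r \<le> mdist A x y"
  shows "\<exists>\<mu>\<in>borel_probs A. energy A \<mu> \<le> 1 / card X + exp (- r)"
proof -
  obtain x0 where x0: "x0 \<in> X" using X by blast
  \<comment> \<open>Clamping to \<open>X\<close> affects a null set only; it makes the map total into \<open>mspace A\<close>.\<close>
  define f where "f = (\<lambda>x. if x \<in> X then x else x0)"
  define \<mu> where "\<mu> = distr (measure_pmf (pmf_of_set X)) (metric_borel A) f"
  have f: "f \<in> measurable (measure_pmf (pmf_of_set X)) (metric_borel A)"
    using X x0 by (simp add: f_def subset_iff)
  have \<mu>: "\<mu> \<in> borel_probs A"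
    using measure_pmf.prob_space_distr[OF f] by (simp add: borel_probs_def \<mu>_def)
  have int: "(\<integral>a. g a \<partial>\<mu>) = (\<Sum>a\<in>X. g a) / card X"
    if "g \<in> borel_measurable (metric_borel A)" for g :: "'a \<Rightarrow> real"
  proof -
    have "(\<integral>a. g a \<partial>\<mu>) = (\<integral>x. g (f x) \<partial>measure_pmf (pmf_of_set X))"
      unfolding \<mu>_def using f that by (rule integral_distr)
    also have "\<dots> = (\<Sum>a\<in>X. g (f a)) / card X"
      using X by (subst integral_pmf_of_set) auto
    also have "(\<Sum>a\<in>X. g (f a)) = (\<Sum>a\<in>X. g a)"
      by (simp add: f_def)
    finally show ?thesis .
  qed
  define m where "m = card X"
  have m: "m > 0" using X by (simp add: m_def card_gt_0_iff)
  have "energy A \<mu> = (\<Sum>b\<in>X. \<integral>a. exp (- mdist A a b) \<partial>\<mu>) / m"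
    unfolding energy_def m_def by (rule int[OF potential_measurable[OF \<mu>]])
  also have "(\<Sum>b\<in>X. \<integral>a. exp (- mdist A a b) \<partial>\<mu>) = (\<Sum>b\<in>X. (\<Sum>a\<in>X. exp (- mdist A a b)) / m)"
    using X by (intro sum.cong refl, subst int) (auto intro: kernel_measurable simp: m_def)
  also have "\<dots> \<le> (\<Sum>b\<in>X. (1 + m * exp (- r)) / m)"
  proof (intro sum_mono divide_right_mono)
    fix b assume b: "b \<in> X"
    have "(\<Sum>a\<in>X. exp (- mdist A a b)) \<le> (\<Sum>a\<in>X. (if a = b then 1 else 0) + exp (- r))"
    proof (rule sum_mono)
      fix a assume a: "a \<in> X"
      show "exp (- mdist A a b) \<le> (if a = b then 1 else 0) + exp (- r)"
      proof (cases "a = b")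
        case True
        then have "mdist A a b = 0" using b X by auto
        then show ?thesis using True by simp
      qed (use sep[OF a b] in simp)
    qed
    also have "\<dots> = 1 + m * exp (- r)"
      using b X by (simp add: sum.distrib m_def)
    finally show "(\<Sum>a\<in>X. exp (- mdist A a b)) \<le> 1 + m * exp (- r)" .
  qed simp
  also have "\<dots> = 1 + m * exp (- r)" using m by (simp add: m_def)
  finally have "energy A \<mu> \<le> (1 + m * exp (- r)) / m"
    using m by (simp add: divide_right_mono)
  also have "\<dots> = 1 / m + exp (- r)" using m by (simp add: field_simps)
  finally show ?thesis using \<mu> by (auto simp: m_def)
qed

section \<open>Covering numbers of compact spaces\<close>

lemma compact_ex_finite_net:
  assumes "compact_space (mtopology_of A)" "r > 0"
  shows "\<exists>K. finite K \<and> K \<subseteq> mspace A \<and> (\<forall>x\<in>mspace A. \<exists>k\<in>K. mdist A k x < r)"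
proof -
  have "Metric_space.mtotally_bounded (mspace A) (mdist A) (mspace A)"
    using assms(1)
    by (simp add: mtopology_of_def Metric_space.compact_space_eq_mcomplete_mtotally_bounded[OF Metric_space_mspace_mdist])
  then obtain K where K: "finite K" "K \<subseteq> mspace A"
      "mspace A \<subseteq> (\<Union>x\<in>K. Metric_space.mball (mspace A) (mdist A) x r)"
    using assms(2) unfolding Metric_space.mtotally_bounded_def[OF Metric_space_mspace_mdist] by meson
  then have "\<forall>x\<in>mspace A. \<exists>k\<in>K. x \<in> mball_of A k r"
    unfolding mball_of_def by blast
  then have "\<forall>x\<in>mspace A. \<exists>k\<in>K. mdist A k x < r"
    by (meson in_mball_of)
  with K show ?thesis by blast
qed

lemma covering_number_attained:
  assumes "compact_space (mtopology_of A)" "r > 0"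
  obtains \<B> where "finite \<B>" "card \<B> = covering_number A r"
    "\<B> \<subseteq> (\<lambda>x. mcball_of A x r) ` mspace A" "mspace A \<subseteq> \<Union>\<B>"
proof -
  obtain K where K: "finite K" "K \<subseteq> mspace A" "\<forall>x\<in>mspace A. \<exists>k\<in>K. mdist A k x < r"
    using compact_ex_finite_net[OF assms] by blast
  let ?B = "(\<lambda>x. mcball_of A x r) ` K"
  have "x \<in> \<Union>?B" if "x \<in> mspace A" for x
  proof -
    obtain k where "k \<in> K" "mdist A k x < r" using K(3) \<open>x \<in> mspace A\<close> by blast
    then have "x \<in> mcball_of A k r" using K(2) \<open>x \<in> mspace A\<close> by auto
    with \<open>k \<in> K\<close> show ?thesis by blast
  qed
  then have "\<exists>n \<B>. finite \<B> \<and> card \<B> = n \<and> \<B> \<subseteq> (\<lambda>x. mcball_of A x r) ` mspace A \<and> mspace A \<subseteq> \<Union>\<B>"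
    by (intro exI[of _ "card ?B"] exI[of _ ?B]) (use K(1,2) in blast)
  then have "\<exists>\<B>. finite \<B> \<and> card \<B> = covering_number A r
      \<and> \<B> \<subseteq> (\<lambda>x. mcball_of A x r) ` mspace A \<and> mspace A \<subseteq> \<Union>\<B>"
    unfolding covering_number_def by (rule LeastI_ex)
  then show ?thesis using that by blast
qed

lemma covering_number_pos:
  assumes "compact_space (mtopology_of A)" "r > 0" "mspace A \<noteq> {}"
  shows "covering_number A r > 0"
proof -
  obtain \<B> where B: "finite \<B>" "card \<B> = covering_number A r" "mspace A \<subseteq> \<Union>\<B>"
    using covering_number_attained[OF assms(1,2)] by metis
  then have "\<B> \<noteq> {}" using assms(3) by auto
  then show ?thesis using B(1) by (simp add: card_gt_0_iff flip: B(2))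
qed

text \<open>A separated set of maximal cardinality is the set of centres of a cover. The cardinalities are
  bounded because two points of the set cannot share a ball of half the radius.\<close>
lemma ex_separated_card_ge_covering_number:
  assumes "compact_space (mtopology_of A)" "r > 0"
  shows "\<exists>X. finite X \<and> X \<subseteq> mspace A \<and> (\<forall>x\<in>X. \<forall>y\<in>X. x \<noteq> y \<longrightarrow> r \<le> mdist A x y)
    \<and> covering_number A r \<le> card X"
proof -
  define S where "S = (\<lambda>X. finite X \<and> X \<subseteq> mspace A \<and> (\<forall>x\<in>X. \<forall>y\<in>X. x \<noteq> y \<longrightarrow> r \<le> mdist A x y))"
  obtain K where K: "finite K" "K \<subseteq> mspace A" "\<forall>x\<in>mspace A. \<exists>k\<in>K. mdist A k x < r / 2"
    using compact_ex_finite_net[OF assms(1), of "r / 2"] assms(2) by auto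
  have bound: "card X \<le> card K" if "S X" for X
  proof -
    from K(3) obtain c where c: "\<And>x. x \<in> mspace A \<Longrightarrow> c x \<in> K \<and> mdist A (c x) x < r / 2"
      by metis
    have "inj_on c X"
    proof (rule inj_onI, rule ccontr)
      fix x y assume xy: "x \<in> X" "y \<in> X" "c x = c y" "x \<noteq> y"
      then have "x \<in> mspace A" "y \<in> mspace A" "c x \<in> mspace A"
        using that c K(2) by (auto simp: S_def)
      then have "mdist A x y < r"
        using mdist_triangle[of x A "c x" y] c[of x] c[of y] xy(3)
        by (simp add: mdist_commute)
      moreover have "r \<le> mdist A x y" using that xy by (auto simp: S_def)
      ultimately show False by simp
    qed
    moreover have "c ` X \<subseteq> K" using that c by (auto simp: S_def)
    ultimately show ?thesis using K(1) by (rule card_inj_on_le)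
  qed
  have "S {}" by (simp add: S_def)
  then obtain X where X: "S X" "\<And>Y. S Y \<Longrightarrow> card Y \<le> card X"
    using ex_has_greatest_nat[of S "{}" card "card K + 1"] bound by (metis le_imp_less_Suc Suc_eq_plus1)
  let ?B = "(\<lambda>x. mcball_of A x r) ` X"
  have "y \<in> \<Union>?B" if y: "y \<in> mspace A" for y
  proof (rule ccontr)
    assume "y \<notin> \<Union>?B"
    then have far: "mdist A x y > r" if "x \<in> X" for x
      using that y X(1) by (force simp: S_def)
    have "y \<notin> X"
    proof
      assume "y \<in> X"
      from far[OF this] have "r < mdist A y y" .
      moreover have "mdist A y y = 0" using y by simp
      ultimately show False using assms(2) by simp
    qed
    moreover have "S (insert y X)"
      using X(1) far y by (auto simp: S_def mdist_commute less_imp_le)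
    ultimately show False
      using X(2)[of "insert y X"] X(1) by (simp add: S_def)
  qed
  then have "\<exists>\<B>. finite \<B> \<and> card \<B> = card ?B \<and> \<B> \<subseteq> (\<lambda>x. mcball_of A x r) ` mspace A \<and> mspace A \<subseteq> \<Union>\<B>"
    using X(1) by (intro exI[of _ ?B]) (auto simp: S_def)
  then have "covering_number A r \<le> card ?B"
    unfolding covering_number_def by (rule Least_le)
  also have "\<dots> \<le> card X" using X(1) by (intro card_image_le) (simp add: S_def)
  finally show ?thesis using X(1) by (auto simp: S_def)
qed

section \<open>Two-sided bounds on the maximum diversity\<close>

context
  fixes A :: "'a metric"
  assumes compact: "compact_space (mtopology_of A)" and nonempty: "mspace A \<noteq> {}"
begin

lemma inverse_energy_bounds:
  assumes "\<mu> \<in> borel_probs A" "r > 0"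
  shows "energy A \<mu> > 0" "inverse (energy A \<mu>) \<le> exp (2 * r) * covering_number A r"
proof -
  obtain \<B> where "finite \<B>" "card \<B> = covering_number A r"
    "\<B> \<subseteq> (\<lambda>x. mcball_of A x r) ` mspace A" "mspace A \<subseteq> \<Union>\<B>"
    using covering_number_attained[OF compact assms(2)] by metis
  then have E: "exp (- 2 * r) \<le> energy A \<mu> * covering_number A r"
    using energy_ge_of_cover[OF assms(1)] by metis
  show pos: "energy A \<mu> > 0"
  proof (rule ccontr)
    assume "\<not> energy A \<mu> > 0"
    then have "energy A \<mu> * covering_number A r \<le> 0"
      by (simp add: mult_nonpos_nonneg)
    with E show False using exp_gt_zero[of "- 2 * r"] by linarith
  qed
  have "1 = exp (2 * r) * exp (- 2 * r)" by (simp flip: exp_add)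
  also have "\<dots> \<le> exp (2 * r) * (energy A \<mu> * covering_number A r)"
    using E by (intro mult_left_mono) auto
  finally show "inverse (energy A \<mu>) \<le> exp (2 * r) * covering_number A r"
    using pos by (simp add: inverse_eq_divide pos_divide_le_eq mult_ac)
qed

lemma borel_probs_nonempty: "borel_probs A \<noteq> {}"
proof -
  obtain x where "x \<in> mspace A" using nonempty by blast
  then have "\<exists>\<mu>\<in>borel_probs A. energy A \<mu> \<le> 1 / card {x} + exp (- 0)"
    by (intro ex_energy_le_of_separated) auto
  then show ?thesis by blast
qed

lemma max_diversity_le:
  assumes "r > 0"
  shows "max_diversity A \<le> exp (2 * r) * covering_number A r"
  unfolding max_diversity_eq_SUP_energy
  by (rule cSUP_least[OF borel_probs_nonempty]) (rule inverse_energy_bounds(2)[OF _ assms])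

lemma max_diversity_ge:
  assumes "r > 0"
  shows "max_diversity A \<ge> inverse (1 / covering_number A r + exp (- r))"
proof -
  obtain X where X: "finite X" "X \<subseteq> mspace A" "\<forall>x\<in>X. \<forall>y\<in>X. x \<noteq> y \<longrightarrow> r \<le> mdist A x y"
      "covering_number A r \<le> card X"
    using ex_separated_card_ge_covering_number[OF compact assms] by blast
  have N: "covering_number A r > 0" using covering_number_pos[OF compact assms nonempty] .
  then have "X \<noteq> {}" using X(4) by auto
  then obtain \<mu> where \<mu>: "\<mu> \<in> borel_probs A" "energy A \<mu> \<le> 1 / card X + exp (- r)"
    using ex_energy_le_of_separated[of X A r] X by blast
  have "1 / real (card X) \<le> 1 / covering_number A r"
    using X(4) N by (intro divide_left_mono) auto
  then have "inverse (1 / covering_number A r + exp (- r)) \<le> inverse (energy A \<mu>)"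
    using \<mu> inverse_energy_bounds(1)[OF \<mu>(1) assms] by (intro le_imp_inverse_le) auto
  also have "\<dots> \<le> max_diversity A"
    unfolding max_diversity_eq_SUP_energy
    using \<mu>(1) inverse_energy_bounds(2)[OF _ assms] by (intro cSUP_upper bdd_aboveI2)
  finally show ?thesis .
qed

lemma ln_max_diversity_ge:
  assumes "r > 0"
  shows "ln (max_diversity A) \<ge> min (ln (covering_number A r)) r - ln 2"
    and "max_diversity A > 0"
proof -
  define N where "N = real (covering_number A r)"
  have N: "N > 0" using covering_number_pos[OF compact assms nonempty] by (simp add: N_def)
  define u where "u = min (ln N) r"
  have "1 / N = exp (- ln N)" using N by (simp add: exp_minus field_simps)
  then have "1 / N + exp (- r) \<le> exp (- u) + exp (- u)"
    by (intro add_mono) (auto simp: u_def)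
  moreover have "1 / N + exp (- r) > 0" using N by (simp add: add_pos_pos)
  ultimately have "inverse (2 * exp (- u)) \<le> inverse (1 / N + exp (- r))"
    by (intro le_imp_inverse_le) auto
  also have "\<dots> \<le> max_diversity A" using max_diversity_ge[OF assms] by (simp add: N_def)
  finally have D: "inverse (2 * exp (- u)) \<le> max_diversity A" .
  have pos: "inverse (2 * exp (- u)) > 0" by simp
  from pos D show "max_diversity A > 0" by (rule less_le_trans)
  have "ln (inverse (2 * exp (- u))) \<le> ln (max_diversity A)"
    using D pos less_le_trans[OF pos D] by (simp only: ln_le_cancel_iff)
  moreover have "ln (inverse (2 * exp (- u))) = u - ln 2"
    by (simp add: exp_minus ln_div)
  ultimately show "ln (max_diversity A) \<ge> min (ln (covering_number A r)) r - ln 2"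
    by (simp only: u_def N_def)
qed

lemma ln_max_diversity_le:
  assumes "r > 0"
  shows "ln (max_diversity A) \<le> 2 * r + ln (covering_number A r)"
proof -
  have N: "covering_number A r > 0" using covering_number_pos[OF compact assms nonempty] .
  have "ln (max_diversity A) \<le> ln (exp (2 * r) * covering_number A r)"
    using max_diversity_le[OF assms] ln_max_diversity_ge(2)[OF assms] N
    by (subst ln_le_cancel_iff) auto
  then show ?thesis using N by (simp add: ln_mult)
qed

end

section \<open>Scaling\<close>

lemma mtopology_of_scale_metric:
  assumes "t > 0"
  shows "mtopology_of (scale_metric t A) = mtopology_of A"
proof (rule topology_eq[THEN iffD2], rule allI)
  fix U
  have ball: "mball_of (scale_metric t A) x (t * r) = mball_of A x r" for x r
    using assms by auto
  have "(\<exists>r>0. mball_of (scale_metric t A) x r \<subseteq> U) \<longleftrightarrow> (\<exists>r>0. mball_of A x r \<subseteq> U)" for x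
  proof
    assume "\<exists>r>0. mball_of (scale_metric t A) x r \<subseteq> U"
    then obtain r where "r > 0" "mball_of (scale_metric t A) x r \<subseteq> U" by blast
    then show "\<exists>r>0. mball_of A x r \<subseteq> U"
      using ball[of x "r / t"] assms by (intro exI[of _ "r / t"]) auto
  next
    assume "\<exists>r>0. mball_of A x r \<subseteq> U"
    then obtain r where "r > 0" "mball_of A x r \<subseteq> U" by blast
    then show "\<exists>r>0. mball_of (scale_metric t A) x r \<subseteq> U"
      using ball[of x r] assms by (intro exI[of _ "t * r"]) auto
  qed
  then show "openin (mtopology_of (scale_metric t A)) U = openin (mtopology_of A) U"
    using assms by (simp add: openin_mtopology_of)
qed

lemma covering_number_scale_metric:
  assumes "t > 0"
  shows "covering_number (scale_metric t A) (t * r) = covering_number A r"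
proof -
  have "mcball_of (scale_metric t A) x (t * r) = mcball_of A x r" for x
    using assms by auto
  then show ?thesis using assms by (simp add: covering_number_def)
qed

section \<open>Comparing growth exponents\<close>

text \<open>Phrased with strict lower thresholds so that one hypothesis serves both the lower and the upper
  limit.\<close>
lemma Liminf_Limsup_mono_thresholds:
  fixes f g :: "'b \<Rightarrow> real"
  assumes F: "F \<noteq> bot"
    and *: "\<And>c c'. c' < c \<Longrightarrow> \<forall>\<^sub>F x in F. c < g x \<longrightarrow> c' < f x"
  shows "Liminf F (\<lambda>x. ereal (g x)) \<le> Liminf F (\<lambda>x. ereal (f x))"
    and "Limsup F (\<lambda>x. ereal (g x)) \<le> Limsup F (\<lambda>x. ereal (f x))"
proof -
  show "Liminf F (\<lambda>x. ereal (g x)) \<le> Liminf F (\<lambda>x. ereal (f x))"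
  proof (rule ccontr)
    assume "\<not> ?thesis"
    then obtain c' where c': "Liminf F (\<lambda>x. ereal (f x)) < ereal c'" "ereal c' < Liminf F (\<lambda>x. ereal (g x))"
      using ereal_dense2[of "Liminf F (\<lambda>x. ereal (f x))"] by (auto simp: not_le)
    then obtain c where c: "ereal c' < ereal c" "ereal c < Liminf F (\<lambda>x. ereal (g x))"
      using ereal_dense2[of "ereal c'"] by blast
    have "\<forall>\<^sub>F x in F. c < g x" using less_LiminfD[OF c(2)] by simp
    with *[of c' c] c(1) have "\<forall>\<^sub>F x in F. c' < f x"
      by (auto elim: eventually_elim2)
    then have "ereal c' \<le> Liminf F (\<lambda>x. ereal (f x))"
      by (intro Liminf_bounded) (auto elim: eventually_mono)
    with c'(1) show False by simp
  qed
  show "Limsup F (\<lambda>x. ereal (g x)) \<le> Limsup F (\<lambda>x. ereal (f x))"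
  proof (rule ccontr)
    assume "\<not> ?thesis"
    then obtain c' where c': "Limsup F (\<lambda>x. ereal (f x)) < ereal c'" "ereal c' < Limsup F (\<lambda>x. ereal (g x))"
      using ereal_dense2[of "Limsup F (\<lambda>x. ereal (f x))"] by (auto simp: not_le)
    then obtain c where c: "ereal c' < ereal c" "ereal c < Limsup F (\<lambda>x. ereal (g x))"
      using ereal_dense2[of "ereal c'"] by blast
    have "\<forall>\<^sub>F x in F. f x < c'" using Limsup_lessD[OF c'(1)] by simp
    with *[of c' c] c(1) have "\<forall>\<^sub>F x in F. g x \<le> c"
      by (auto elim: eventually_elim2)
    then have "Limsup F (\<lambda>x. ereal (g x)) \<le> ereal c"
      by (intro Limsup_bounded) (auto elim: eventually_mono)
    with c(2) show False by simp
  qed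
qed

lemma filterlim_Liminf_Limsup:
  fixes g :: "'a \<Rightarrow> ereal"
  assumes "filterlim f G F"
  shows "Liminf G g \<le> Liminf F (\<lambda>x. g (f x))" "Limsup F (\<lambda>x. g (f x)) \<le> Limsup G g"
  using assms
  by (auto simp: le_Liminf_iff Limsup_le_iff filterlim_iff dest: less_LiminfD Limsup_lessD)

context
  fixes A :: "'a metric"
  assumes compact: "compact_space (mtopology_of A)" and nonempty: "mspace A \<noteq> {}"
begin

abbreviation (input) div_quot :: "real \<Rightarrow> real" where
  "div_quot t \<equiv> ln (max_diversity (scale_metric t A)) / ln t"

abbreviation (input) mink_quot :: "real \<Rightarrow> real" where
  "mink_quot \<epsilon> \<equiv> ln (real (covering_number A \<epsilon>)) / ln (1 / \<epsilon>)"

lemma ln_max_diversity_scale_bounds: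
  assumes "t > 0" "\<epsilon> > 0"
  shows "ln (max_diversity (scale_metric t A)) \<le> 2 * (t * \<epsilon>) + ln (covering_number A \<epsilon>)"
    and "ln (max_diversity (scale_metric t A)) \<ge> min (ln (covering_number A \<epsilon>)) (t * \<epsilon>) - ln 2"
proof -
  have "compact_space (mtopology_of (scale_metric t A))" "mspace (scale_metric t A) \<noteq> {}"
    using assms compact nonempty by (auto simp: mtopology_of_scale_metric)
  moreover have "t * \<epsilon> > 0" using assms by simp
  ultimately show "ln (max_diversity (scale_metric t A)) \<le> 2 * (t * \<epsilon>) + ln (covering_number A \<epsilon>)"
    and "ln (max_diversity (scale_metric t A)) \<ge> min (ln (covering_number A \<epsilon>)) (t * \<epsilon>) - ln 2"
    using ln_max_diversity_le[of "scale_metric t A" "t * \<epsilon>"]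
      ln_max_diversity_ge(1)[of "scale_metric t A" "t * \<epsilon>"] assms
    by (simp_all add: covering_number_scale_metric)
qed

text \<open>Taking \<open>\<epsilon> = 1 / t\<close> loses only the bounded factor \<open>exp 2\<close>.\<close>
lemma div_dim_le_mink_dim:
  "lower_div_dim A \<le> lower_mink_dim A" "upper_div_dim A \<le> upper_mink_dim A"
proof -
  have thr: "\<forall>\<^sub>F \<epsilon> in at_right 0. c < div_quot (inverse \<epsilon>) \<longrightarrow> c' < mink_quot \<epsilon>"
    if "c' < c" for c c' :: real
  proof -
    have "((\<lambda>\<epsilon>::real. 2 / ln (1 / \<epsilon>)) \<longlongrightarrow> 0) (at_right 0)" by real_asymp
    then have "\<forall>\<^sub>F \<epsilon> in at_right (0::real). 2 / ln (1 / \<epsilon>) < c - c'"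
      using that by (intro order_tendstoD(2)) auto
    moreover have "\<forall>\<^sub>F \<epsilon> in at_right (0::real). 0 < \<epsilon>" by real_asymp
    moreover have "\<forall>\<^sub>F \<epsilon> in at_right (0::real). 0 < ln (1 / \<epsilon>)" by real_asymp
    ultimately show ?thesis
    proof eventually_elim
      case (elim \<epsilon>)
      have "div_quot (inverse \<epsilon>) \<le> (2 + ln (covering_number A \<epsilon>)) / ln (1 / \<epsilon>)"
        using elim ln_max_diversity_scale_bounds(1)[of "inverse \<epsilon>" \<epsilon>]
        by (simp add: divide_right_mono inverse_eq_divide)
      then show ?case using elim by (simp add: add_divide_distrib)
    qed
  qed
  have "lower_div_dim A = Liminf (at_right 0) (\<lambda>\<epsilon>. ereal (div_quot (inverse \<epsilon>)))"
    "upper_div_dim A = Limsup (at_right 0) (\<lambda>\<epsilon>. ereal (div_quot (inverse \<epsilon>)))"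
    unfolding lower_div_dim_def upper_div_dim_def at_top_to_right
    by (intro Liminf_filtermap_eq Limsup_filtermap_eq, simp add: inj_on_def)+
  then show "lower_div_dim A \<le> lower_mink_dim A" "upper_div_dim A \<le> upper_mink_dim A"
    using Liminf_Limsup_mono_thresholds[OF _ thr]
    by (simp_all add: lower_mink_dim_def upper_mink_dim_def)
qed

text \<open>Divide the lower bound on \<open>ln (max_diversity (scale_metric t A))\<close> by \<open>ln t\<close>. By \<open>ratio\<close> the first
  argument of the minimum keeps its exponent, and by \<open>fast\<close> the second one exceeds every finite
  exponent, so that it is irrelevant even when the Minkowski dimensions are infinite.\<close>
lemma mink_quot_le_div_quot_along:
  fixes F :: "'b filter" and t \<epsilon> :: "'b \<Rightarrow> real"
  assumes t: "filterlim t at_top F" and \<epsilon>: "\<forall>\<^sub>F s in F. 0 < \<epsilon> s \<and> \<epsilon> s < 1"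
    and ratio: "((\<lambda>s. ln (1 / \<epsilon> s) / ln (t s)) \<longlongrightarrow> 1) F"
    and fast: "filterlim (\<lambda>s. t s * \<epsilon> s / ln (t s)) at_top F"
    and "c' < c"
  shows "\<forall>\<^sub>F s in F. c < mink_quot (\<epsilon> s) \<longrightarrow> c' < div_quot (t s)"
proof -
  have ln_t: "filterlim (\<lambda>s. ln (t s)) at_top F"
    using filterlim_compose[OF ln_at_top t] .
  have err: "((\<lambda>s. ln 2 / ln (t s)) \<longlongrightarrow> 0) F"
    using filterlim_at_top_imp_at_infinity[OF ln_t] by (rule tendsto_divide_0[OF tendsto_const])
  have "((\<lambda>s. c * (ln (1 / \<epsilon> s) / ln (t s)) - ln 2 / ln (t s)) \<longlongrightarrow> c * 1 - 0) F"
    by (intro tendsto_intros ratio err)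
  then have "\<forall>\<^sub>F s in F. c' < c * (ln (1 / \<epsilon> s) / ln (t s)) - ln 2 / ln (t s)"
    using \<open>c' < c\<close> by (intro order_tendstoD(1)) auto
  moreover have "\<forall>\<^sub>F s in F. ln 2 / ln (t s) < 1"
    using err by (rule order_tendstoD) simp
  moreover have "\<forall>\<^sub>F s in F. c' + 1 < t s * \<epsilon> s / ln (t s)"
    using fast by (simp add: filterlim_at_top_dense)
  moreover have "\<forall>\<^sub>F s in F. 1 < t s"
    using t by (simp add: filterlim_at_top_dense)
  moreover note \<epsilon>
  ultimately show ?thesis
  proof eventually_elim
    case (elim s)
    have pos: "ln (t s) > 0" "ln (1 / \<epsilon> s) > 0" using elim by (auto simp: ln_div)
    show ?case
    proof
      assume "c < mink_quot (\<epsilon> s)"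
      then have "c * ln (1 / \<epsilon> s) < ln (covering_number A (\<epsilon> s))"
        using pos by (simp add: pos_less_divide_eq)
      moreover have "(c' * ln (t s)) < c * ln (1 / \<epsilon> s) - ln 2"
        using elim pos by (simp add: field_simps)
      moreover have "c' * ln (t s) < t s * \<epsilon> s - ln 2"
      proof -
        have "c' + ln 2 / ln (t s) < t s * \<epsilon> s / ln (t s)" using elim by linarith
        from mult_strict_right_mono[OF this pos(1)] show ?thesis
          using pos by (simp add: distrib_right)
      qed
      ultimately have "c' * ln (t s) < min (ln (covering_number A (\<epsilon> s))) (t s * \<epsilon> s) - ln 2"
        by linarith
      also have "\<dots> \<le> ln (max_diversity (scale_metric (t s) A))"
        using elim by (intro ln_max_diversity_scale_bounds(2)) auto
      finally show "c' < div_quot (t s)" using pos by (simp add: pos_less_divide_eq)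
    qed
  qed
qed

text \<open>A lower limit can only increase along a reparametrisation, so \<open>\<epsilon>\<close> is chosen as a function of
  \<open>t\<close>, which runs through all large values.\<close>
lemma lower_mink_dim_le_lower_div_dim: "lower_mink_dim A \<le> lower_div_dim A"
proof -
  define \<epsilon> :: "real \<Rightarrow> real" where "\<epsilon> = (\<lambda>t. (ln t)\<^sup>2 / t)"
  have "filterlim \<epsilon> (at_right 0) at_top" unfolding \<epsilon>_def by real_asymp
  then have "lower_mink_dim A \<le> Liminf at_top (\<lambda>t. ereal (mink_quot (\<epsilon> t)))"
    unfolding lower_mink_dim_def by (rule filterlim_Liminf_Limsup(1))
  also have "\<dots> \<le> lower_div_dim A"
    unfolding lower_div_dim_def
  proof (rule Liminf_Limsup_mono_thresholds(1))
    fix c c' :: real assume "c' < c"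
    then show "\<forall>\<^sub>F t in at_top. c < mink_quot (\<epsilon> t) \<longrightarrow> c' < div_quot t"
    proof (rule mink_quot_le_div_quot_along[rotated -1])
      show "\<forall>\<^sub>F t in at_top. 0 < \<epsilon> t \<and> \<epsilon> t < 1"
        unfolding \<epsilon>_def by (intro eventually_conj; real_asymp)
      show "((\<lambda>t. ln (1 / \<epsilon> t) / ln t) \<longlongrightarrow> 1) at_top" unfolding \<epsilon>_def by real_asymp
      show "filterlim (\<lambda>t. t * \<epsilon> t / ln t) at_top at_top" unfolding \<epsilon>_def by real_asymp
    qed (rule filterlim_ident)
  qed simp
  finally show ?thesis .
qed

text \<open>An upper limit can only decrease along a reparametrisation, so this time \<open>t\<close> is chosen as a
  function of \<open>\<epsilon>\<close>, which runs through all small values.\<close>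
lemma upper_mink_dim_le_upper_div_dim: "upper_mink_dim A \<le> upper_div_dim A"
proof -
  define t :: "real \<Rightarrow> real" where "t = (\<lambda>\<epsilon>. (ln \<epsilon>)\<^sup>2 / \<epsilon>)"
  have t: "filterlim t at_top (at_right 0)" unfolding t_def by real_asymp
  have "upper_mink_dim A \<le> Limsup (at_right 0) (\<lambda>\<epsilon>. ereal (div_quot (t \<epsilon>)))"
    unfolding upper_mink_dim_def
  proof (rule Liminf_Limsup_mono_thresholds(2))
    fix c c' :: real assume "c' < c"
    then show "\<forall>\<^sub>F \<epsilon> in at_right 0. c < mink_quot \<epsilon> \<longrightarrow> c' < div_quot (t \<epsilon>)"
    proof (rule mink_quot_le_div_quot_along[rotated -1])
      show "\<forall>\<^sub>F \<epsilon> in at_right (0::real). 0 < \<epsilon> \<and> \<epsilon> < 1"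
        by (intro eventually_conj; real_asymp)
      show "((\<lambda>\<epsilon>. ln (1 / \<epsilon>) / ln (t \<epsilon>)) \<longlongrightarrow> 1) (at_right 0)" unfolding t_def by real_asymp
      show "filterlim (\<lambda>\<epsilon>. t \<epsilon> * \<epsilon> / ln (t \<epsilon>)) at_top (at_right 0)" unfolding t_def by real_asymp
    qed (rule t)
  qed simp
  also have "\<dots> \<le> upper_div_dim A"
    unfolding upper_div_dim_def using t by (rule filterlim_Liminf_Limsup(2))
  finally show ?thesis .
qed

end

theorem theorem7p1:
  fixes A :: "'a metric"
  assumes "compact_space (mtopology_of A)"
    and "mspace A \<noteq> {}"
  shows "lower_div_dim A = lower_mink_dim A
    \<and> upper_div_dim A = upper_mink_dim A
    \<and> (div_dim_defined A \<longleftrightarrow> mink_dim_defined A)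
    \<and> (div_dim_defined A \<longrightarrow> div_dim A = mink_dim A)"
proof -
  have "lower_div_dim A = lower_mink_dim A"
    using div_dim_le_mink_dim(1)[OF assms] lower_mink_dim_le_lower_div_dim[OF assms]
    by (rule antisym)
  moreover have "upper_div_dim A = upper_mink_dim A"
    using div_dim_le_mink_dim(2)[OF assms] upper_mink_dim_le_upper_div_dim[OF assms]
    by (rule antisym)
  ultimately show ?thesis
    by (simp add: div_dim_defined_def mink_dim_defined_def div_dim_def mink_dim_def)
qed

end
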